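(* Let $N=\{1,\dots,n\}$, $1>q_1\ge\dots\ge q_n\ge0$, and $f(\mathbf{x})=\max\{0,\max_{i\in N}\{q_i-x_i\}\}$ for $\mathbf{x}\in\mathbb{Z}^n$. For any $\mathbf{p}\in\mathbb{Z}^n$ and any permutation $\boldsymbol\delta$ of $N$, let $p_{\min}=\min_{i\in N}p_i$ and let $K\subseteq N$ be the set constructed from $(\mathbf{p},\boldsymbol\delta)$ by the procedure in the context. Then the SEPI for $f$ associated with $\mathbf{p}$ and $\boldsymbol\delta$ is - $w\ge0$, the mixing inequality with respect to $K=\emptyset$, if $p_{\min}\ge1$; - the mixing inequality $w\ge\sum_{k=1}^{|K|}(q_{\sigma(k)}-q_{\sigma(k+1)})(1-x_{\sigma(k)})$ with respect to $K$, if $p_{\min}=0$; - the mixing inequality $w\ge\sum_{k=1}^{|K|}(q_{\sigma(k)}-q_{\sigma(k+1)})(1-x_{\sigma(k)})-(1-q_{\sigma(1)})x_{\sigma(|K|)}$ with respect to $K$, otherwise. Here, in a mixing inequality with respect to $K$, $\boldsymbol\sigma=(\sigma(1),\dots,\sigma(|K|))$ is any (in case of ties) ordering of the elements of $K$ with $q_{\sigma(1)}\ge\dots\ge q_{\sigma(|K|)}$, and $q_{\sigma(|K|+1)}=0$.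
   Context: For $\mathbf{p}\in\mathbb{Z}^n$ and a permutation $\boldsymbol\delta$ of $N$, the SEPI (shifted extremal polymatroid inequality) for $f$ associated with $(\mathbf{p},\boldsymbol\delta)$ is $$w\ge f(\mathbf{p})+\sum_{i=1}^n\Big[f\Big(\mathbf{p}+\sum_{j=1}^{i}\mathbf{1}^{\delta(j)}\Big)-f\Big(\mathbf{p}+\sum_{j=1}^{i-1}\mathbf{1}^{\delta(j)}\Big)\Big](x_{\delta(i)}-p_{\delta(i)}),$$ with $\mathbf{1}^i$ the $i$-th unit vector. $\delta^{-1}(i)$ denotes the position of $i$ in $\boldsymbol\delta$, i.e. $\delta^{-1}(i)=j$ iff $\delta(j)=i$. Construction of $K$. If $p_{\min}\ge1$, $K=\emptyset$. Otherwise let $N_{p_{\min}}=\{i\in N:p_i=p_{\min}\}$, $k_1=\min N_{p_{\min}}$, and, as long as $\{i\in N_{p_{\min}}:\delta^{-1}(i)>\delta^{-1}(k_\kappa)\}\ne\emptyset$, let $k_{\kappa+1}$ be the minimum of this set; let $k_L$ be the last element so obtained. If $p_{\min}=0$, then $K=\{k_1,\dots,k_L\}$. If $p_{\min}\le-1$, let $N_{p_{\min}+1}=\{i\in N:p_i=p_{\min}+1\}$. If $\{i\in N_{p_{\min}+1}:\delta^{-1}(i)>\delta^{-1}(k_L),\ i<k_1\}$ is empty, then $K=\{k_1,\dots,k_L\}$; otherwise let $k'_1$ be its minimum and, as long as $\{i\in N_{p_{\min}+1}:\delta^{-1}(i)>\delta^{-1}(k'_{\kappa'}),\ i<k_1\}\neq\emptyset$,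 let $k'_{\kappa'+1}$ be the minimum of this set; with $k'_{L'}$ the last element so obtained, $K=\{k_1,\dots,k_L\}\cup\{k'_1,\dots,k'_{L'}\}$.
   Formalization: "Any (in case of ties) ordering" fails for q=(1/2,1/2), p=(0,0), identity δ, σ=(2,1); here σ ranges over the orderings of K with q nonincreasing in which, among elements of equal q, the one of greatest index comes last, and such a σ is shown to exist. *)

theory Defs
  imports Complex_Main "HOL-Combinatorics.Permutations"
begin

text \<open>
  The ground set is \<open>N = {1..n}\<close>. Vectors indexed by \<open>N\<close> are functions on \<^typ>\<open>nat\<close> of which only
  the values on \<open>{1..n}\<close> matter. An inequality in the variables \<open>(x, w)\<close> is represented by the
  predicate on \<open>x\<close> (a real vector) and \<open>w\<close> (a real number) which it expresses. All inequalities
  below have the form \<open>w \<ge> c + (\<Sum>i\<in>N. a i * x i)\<close>, so two of them are equal as predicates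
  iff their constants and their coefficients agree.
\<close>

definition mix_fun :: "nat \<Rightarrow> (nat \<Rightarrow> real) \<Rightarrow> (nat \<Rightarrow> int) \<Rightarrow> real" where
  "mix_fun n q x = max 0 (MAX i\<in>{1..n}. q i - of_int (x i))"

definition unit_vec :: "nat \<Rightarrow> nat \<Rightarrow> int" where
  "unit_vec i = (\<lambda>k. if k = i then 1 else 0)"

definition shifted :: "(nat \<Rightarrow> int) \<Rightarrow> (nat \<Rightarrow> nat) \<Rightarrow> nat \<Rightarrow> nat \<Rightarrow> int" where
  "shifted p \<delta> i = (\<lambda>k. p k + (\<Sum>j=1..i. unit_vec (\<delta> j) k))"

definition SEPI ::
  "nat \<Rightarrow> ((nat \<Rightarrow> int) \<Rightarrow> real) \<Rightarrow> (nat \<Rightarrow> int) \<Rightarrow> (nat \<Rightarrow> nat) \<Rightarrow> (nat \<Rightarrow> real) \<Rightarrow> real \<Rightarrow> bool"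
  where
  "SEPI n f p \<delta> x w \<longleftrightarrow>
     w \<ge> f p + (\<Sum>i=1..n. (f (shifted p \<delta> i) - f (shifted p \<delta> (i - 1))) *
                            (x (\<delta> i) - of_int (p (\<delta> i))))"

definition p_min :: "nat \<Rightarrow> (nat \<Rightarrow> int) \<Rightarrow> int" where
  "p_min n p = (MIN i\<in>{1..n}. p i)"

definition level :: "nat \<Rightarrow> (nat \<Rightarrow> int) \<Rightarrow> int \<Rightarrow> nat set" where
  "level n p v = {i \<in> {1..n}. p i = v}"

text \<open>
  The list starting with \<open>k\<close> in which every element is followed by the least element of \<open>A\<close> whose
  position \<open>pos\<close> is larger, until there is none. Finiteness of \<open>A\<close> only serves totality.
\<close>

function chain :: "nat set \<Rightarrow> (nat \<Rightarrow> nat) \<Rightarrow> nat \<Rightarrow> nat list" where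
  "chain A pos k =
     k # (if finite A \<and> {i \<in> A. pos i > pos k} \<noteq> {}
          then chain A pos (Min {i \<in> A. pos i > pos k}) else [])"
  by pat_completeness auto
termination
proof (relation "measure (\<lambda>(A, pos, k). card {i \<in> A. pos i > pos k})", goal_cases)
  case 1
  show ?case by simp
next
  case (2 A pos k)
  let ?T = "{i \<in> A. pos i > pos k}"
  have fin: "finite ?T" using 2 by simp
  have m: "Min ?T \<in> ?T" using 2 fin by (intro Min_in) auto
  have "{i \<in> A. pos i > pos (Min ?T)} \<subseteq> ?T - {Min ?T}"
    using m by auto
  then have "card {i \<in> A. pos i > pos (Min ?T)} < card ?T"
    using fin m by (meson card_Diff1_less card_mono finite_Diff le_less_trans)
  then show ?case by simp
qed

declare chain.simps [simp del]

definition K_first :: "nat \<Rightarrow> (nat \<Rightarrow> int) \<Rightarrow> (nat \<Rightarrow> nat) \<Rightarrow> nat list" where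
  "K_first n p \<delta> = (let A = level n p (p_min n p) in chain A (inv \<delta>) (Min A))"

definition K_second :: "nat \<Rightarrow> (nat \<Rightarrow> int) \<Rightarrow> (nat \<Rightarrow> nat) \<Rightarrow> nat list" where
  "K_second n p \<delta> =
     (let k1 = hd (K_first n p \<delta>);
          kL = last (K_first n p \<delta>);
          A = {i \<in> level n p (p_min n p + 1). i < k1};
          T = {i \<in> A. inv \<delta> i > inv \<delta> kL}
      in if T = {} then [] else chain A (inv \<delta>) (Min T))"

definition K_set :: "nat \<Rightarrow> (nat \<Rightarrow> int) \<Rightarrow> (nat \<Rightarrow> nat) \<Rightarrow> nat set" where
  "K_set n p \<delta> =
     (if p_min n p \<ge> 1 then {}
      else if p_min n p = 0 then set (K_first n p \<delta>)
      else set (K_first n p \<delta>) \<union> set (K_second n p \<delta>))"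

definition q_ordering :: "(nat \<Rightarrow> real) \<Rightarrow> nat set \<Rightarrow> (nat \<Rightarrow> nat) \<Rightarrow> bool" where
  "q_ordering q K \<sigma> \<longleftrightarrow>
     bij_betw \<sigma> {1..card K} K \<and>
     (\<forall>k\<in>{1..card K}. \<forall>l\<in>{1..card K}. k \<le> l \<longrightarrow> q (\<sigma> k) \<ge> q (\<sigma> l))"

text \<open>
  Restriction under ties: among the elements of \<open>K\<close> with the same value of \<open>q\<close>, the one with the
  greatest index is listed last; the others may come in any order. It is void if \<open>q\<close> is injective
  on \<open>K\<close>. Some restriction is needed: for \<open>q\<^sub>1 = q\<^sub>2 = 1/2\<close> and \<open>K = {1, 2}\<close>, the orderings
  \<open>(1, 2)\<close> and \<open>(2, 1)\<close> give the different inequalities \<open>w \<ge> (1 - x\<^sub>2) / 2\<close> and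
  \<open>w \<ge> (1 - x\<^sub>1) / 2\<close>, and only the former is the SEPI associated with \<open>p = (0, 0)\<close> and the
  identity permutation.
\<close>

definition ties_admissible :: "(nat \<Rightarrow> real) \<Rightarrow> nat set \<Rightarrow> (nat \<Rightarrow> nat) \<Rightarrow> bool" where
  "ties_admissible q K \<sigma> \<longleftrightarrow>
     (\<forall>k\<in>{1..card K}.
        (\<forall>l\<in>{1..card K}. k < l \<longrightarrow> q (\<sigma> l) < q (\<sigma> k)) \<longrightarrow>
        (\<forall>l\<in>{1..card K}. q (\<sigma> l) = q (\<sigma> k) \<longrightarrow> \<sigma> l \<le> \<sigma> k))"

text \<open>The convention \<open>q\<^bsub>\<sigma>(|K|+1)\<^esub> = 0\<close>.\<close>

definition q_ext :: "(nat \<Rightarrow> real) \<Rightarrow> nat set \<Rightarrow> (nat \<Rightarrow> nat) \<Rightarrow> nat \<Rightarrow> real" where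
  "q_ext q K \<sigma> k = (if k = card K + 1 then 0 else q (\<sigma> k))"

definition mixing_ineq1 ::
  "(nat \<Rightarrow> real) \<Rightarrow> nat set \<Rightarrow> (nat \<Rightarrow> nat) \<Rightarrow> (nat \<Rightarrow> real) \<Rightarrow> real \<Rightarrow> bool" where
  "mixing_ineq1 q K \<sigma> x w \<longleftrightarrow>
     w \<ge> (\<Sum>k=1..card K. (q_ext q K \<sigma> k - q_ext q K \<sigma> (k + 1)) * (1 - x (\<sigma> k)))"

definition mixing_ineq2 ::
  "(nat \<Rightarrow> real) \<Rightarrow> nat set \<Rightarrow> (nat \<Rightarrow> nat) \<Rightarrow> (nat \<Rightarrow> real) \<Rightarrow> real \<Rightarrow> bool" where
  "mixing_ineq2 q K \<sigma> x w \<longleftrightarrow>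
     w \<ge> (\<Sum>k=1..card K. (q_ext q K \<sigma> k - q_ext q K \<sigma> (k + 1)) * (1 - x (\<sigma> k)))
          - (1 - q (\<sigma> 1)) * x (\<sigma> (card K))"

end

theory Submission
  imports Defs "HOL-Library.Infinite_Set"
begin

text \<open>
  Call an element of \<open>A\<close> a record if everything at a later position is larger; the chains in the
  construction of \<open>K\<close> list exactly the records. As \<open>q\<close> is antitone, the maximum of \<open>q\<close> over the elements
  of \<open>A\<close> after a given position changes only at records, and after a record \<open>a\<close> it is attained among the
  records \<open>b > a\<close>. If \<open>p\<^sub>m\<^sub>i\<^sub>n \<le> 0\<close>, then along the path from \<open>p\<close> to \<open>p + 1\<close>, \<open>f\<close> is such a maximum over the level \<open>p\<^sub>m\<^sub>i\<^sub>n\<close>,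
  minus \<open>p\<^sub>m\<^sub>i\<^sub>n\<close>, until that level is exhausted at \<open>k\<^sub>L\<close>, and (for \<open>p\<^sub>m\<^sub>i\<^sub>n < 0\<close>) afterwards a maximum
  over the raised level together with the rest of level \<open>p\<^sub>m\<^sub>i\<^sub>n + 1\<close>, minus \<open>p\<^sub>m\<^sub>i\<^sub>n + 1\<close>. Hence the
  coefficient of \<open>x\<^sub>a\<close> in the SEPI is the negative of the gap between \<open>q\<^sub>a\<close> and the maximum of \<open>q\<close>
  over \<open>{b \<in> K. a < b}\<close>, with a correction at \<open>k\<^sub>L = max K\<close>. The mixing inequality has the same
  coefficients: among tied elements only the last one listed contributes.
\<close>

section \<open>Maxima clipped at zero, and their gaps\<close>

text \<open>
  Including \<open>0\<close> gives the empty set the value \<open>0\<close>, which serves both the convention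
  \<open>q\<^bsub>\<sigma>(|K|+1)\<^esub> = 0\<close> and the outer maximum in \<open>f\<close>.
\<close>

definition peak :: "('a \<Rightarrow> real) \<Rightarrow> 'a set \<Rightarrow> real" where
  "peak q S = Max (insert 0 (q ` S))"

lemma peak_le_iff: "finite S \<Longrightarrow> peak q S \<le> c \<longleftrightarrow> 0 \<le> c \<and> (\<forall>a\<in>S. q a \<le> c)"
  by (simp add: peak_def)

lemma peak_nonneg: "finite S \<Longrightarrow> 0 \<le> peak q S"
  by (simp add: peak_def)

lemma peak_ge: "finite S \<Longrightarrow> a \<in> S \<Longrightarrow> q a \<le> peak q S"
  by (simp add: peak_def)

lemma peak_empty [simp]: "peak q {} = 0"
  by (simp add: peak_def)

lemma peak_Un: "finite S \<Longrightarrow> finite T \<Longrightarrow> peak q (S \<union> T) = max (peak q S) (peak q T)"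
proof -
  assume "finite S" "finite T"
  then have "Max (insert 0 (q ` S) \<union> insert 0 (q ` T)) = max (peak q S) (peak q T)"
    unfolding peak_def by (intro Max_Un) auto
  then show ?thesis by (simp add: peak_def image_Un)
qed

lemma peak_eq:
  assumes "finite S" "a \<in> S" "0 \<le> q a" "\<And>b. b \<in> S \<Longrightarrow> q b \<le> q a"
  shows "peak q S = q a"
  using assms by (intro antisym) (auto simp: peak_le_iff peak_ge)

lemma peak_cong_dominated:
  assumes "finite S" "finite T"
    and "\<And>a. a \<in> S \<Longrightarrow> \<exists>b\<in>T. q a \<le> q b" "\<And>b. b \<in> T \<Longrightarrow> \<exists>a\<in>S. q b \<le> q a"
  shows "peak q S = peak q T"
proof (rule antisym)
  show "peak q S \<le> peak q T"
    using assms(1-3) by (auto simp: peak_le_iff peak_nonneg) (meson order_trans peak_ge)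
  show "peak q T \<le> peak q S"
    using assms(1,2,4) by (auto simp: peak_le_iff peak_nonneg) (meson order_trans peak_ge)
qed

text \<open>As \<open>q\<close> is antitone and nonnegative, each gap is the drop of
  \<open>q\<close> from \<open>a\<close> to its successor in \<open>K\<close>, or to 0 after the
  last element, so the sum telescopes. The induction inserts a new minimum, which leaves the other
  gaps unchanged.\<close>

lemma sum_peak_gaps:
  fixes K :: "'a::linorder set"
  assumes "finite K" "\<And>a. a \<in> K \<Longrightarrow> 0 \<le> q a" "antimono_on K q"
  shows "(\<Sum>a\<in>K. q a - peak q {b \<in> K. a < b}) = peak q K"
  using assms
proof (induction K rule: finite_linorder_min_induct)
  case empty
  then show ?case by simp
next
  case (insert b A)
  have anti: "antimono_on A q"
    using insert.prems(2) by (auto simp: monotone_on_def)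
  have "peak q (insert b A) = q b"
    using insert by (intro peak_eq) (auto simp: monotone_on_def less_imp_le)
  moreover have "{c \<in> insert b A. b < c} = A"
    using insert.hyps by auto
  moreover have "{c \<in> insert b A. a < c} = {c \<in> A. a < c}" if "a \<in> A" for a
    using insert.hyps that by auto
  moreover have "b \<notin> A"
    using insert.hyps by auto
  ultimately show ?case
    using insert.IH[OF _ anti] insert.prems(1) insert.hyps(1) by simp
qed

section \<open>Records and the chains that list them\<close>

text \<open>For injective \<open>pos\<close> these are the right-to-left minima of the sequence
  listing \<open>A\<close> by position.\<close>

definition records :: "('a \<Rightarrow> nat) \<Rightarrow> 'a::linorder set \<Rightarrow> 'a set" where
  "records pos A = {a \<in> A. \<forall>b\<in>A. pos a < pos b \<longrightarrow> a < b}"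

lemma records_subset: "records pos A \<subseteq> A"
  by (auto simp: records_def)

lemma finite_records [simp]: "finite A \<Longrightarrow> finite (records pos A)"
  using finite_subset records_subset by blast

text \<open>Whatever comes after the minimum of a tail lies in that tail too, hence is
  larger.\<close>

lemma Min_tail_in_records:
  assumes "finite A" "{a \<in> A. t < pos a} \<noteq> {}"
  shows "Min {a \<in> A. t < pos a} \<in> records pos A" "t < pos (Min {a \<in> A. t < pos a})"
proof -
  let ?T = "{a \<in> A. t < pos a}"
  have m: "Min ?T \<in> ?T"
    using assms by (intro Min_in) auto
  then show "t < pos (Min ?T)" by simp
  have "Min ?T < b" if "b \<in> A" "pos (Min ?T) < pos b" for b
  proof -
    have "b \<in> ?T" using m that by auto
    then have "Min ?T \<le> b" using assms by (intro Min_le) auto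
    then show ?thesis using that by (cases "b = Min ?T") auto
  qed
  then show "Min ?T \<in> records pos A"
    using m by (auto simp: records_def)
qed

text \<open>The minimum \<open>m\<close> is the first record of the tail: a record of the tail
  placed before \<open>m\<close> would have to be smaller than \<open>m\<close>. This is one step of
  \<open>chain\<close>.\<close>

lemma records_tail_step:
  assumes "finite A" "inj_on pos A" "{a \<in> A. t < pos a} \<noteq> {}"
  defines "m \<equiv> Min {a \<in> A. t < pos a}"
  shows "{a \<in> records pos A. t < pos a} = insert m {a \<in> records pos A. pos m < pos a}"
proof -
  have m: "m \<in> records pos A" "t < pos m"
    using Min_tail_in_records[OF assms(1,3)] by (simp_all add: m_def)
  have "pos m < pos a" if a: "a \<in> records pos A" "t < pos a" "a \<noteq> m" for a
  proof (rule ccontr)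
    assume "\<not> pos m < pos a"
    moreover have "a \<in> A" "m \<in> A"
      using a m records_subset by blast+
    ultimately have "pos a < pos m"
      using assms(2) a(3) by (metis inj_on_eq_iff linorder_neqE_nat)
    then have "a < m"
      using a(1) \<open>m \<in> A\<close> by (auto simp: records_def)
    moreover have "m \<le> a"
      unfolding m_def using assms(1) a(2) \<open>a \<in> A\<close> by (intro Min_le) auto
    ultimately show False by simp
  qed
  then show ?thesis using m by auto
qed

lemma records_tail: "records pos {a \<in> A. t < pos a} = {a \<in> records pos A. t < pos a}"
  by (auto simp: records_def)

text \<open>Each recursive call jumps to the first record still ahead. The start \<open>k\<close> is
  inserted separately because it is listed even if it is no record.\<close>

lemma set_chain:
  assumes "finite A" "inj_on pos A"
  shows "set (chain A pos k) = insert k {a \<in> records pos A. pos k < pos a}"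
  using assms
proof (induction A pos k rule: chain.induct)
  case (1 A pos k)
  show ?case
  proof (cases "{i \<in> A. pos k < pos i} = {}")
    case True
    then have "{a \<in> records pos A. pos k < pos a} = {}"
      using records_subset[of pos A] by auto
    then show ?thesis
      by (subst chain.simps) (simp only: True, simp)
  next
    case False
    then show ?thesis
      using 1 records_tail_step[of A pos "pos k"] by (subst chain.simps) simp
  qed
qed

lemma hd_chain: "hd (chain A pos k) = k"
  by (subst chain.simps) simp

text \<open>The recursion stops only when nothing in \<open>A\<close> lies ahead. For the first
  chain, its last element is therefore the one of its level that the path raises last.\<close>

lemma last_chain:
  assumes "finite A" "k \<in> A"
  shows "last (chain A pos k) \<in> A \<and> (\<forall>a\<in>A. pos a \<le> pos (last (chain A pos k)))"
  using assms
proof (induction A pos k rule: chain.induct)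
  case (1 A pos k)
  show ?case
  proof (cases "{i \<in> A. pos k < pos i} = {}")
    case True
    then have "last (chain A pos k) = k"
      by (subst chain.simps) (simp only: True, simp)
    then show ?thesis using True 1 by (auto simp: not_less)
  next
    case False
    let ?m = "Min {i \<in> A. pos k < pos i}"
    have "?m \<in> A"
      using Min_in[of "{i \<in> A. pos k < pos i}"] False 1 by auto
    moreover have "last (chain A pos k) = last (chain A pos ?m)"
    proof -
      have "chain A pos ?m \<noteq> []" by (subst chain.simps) simp
      then show ?thesis using False 1
        by (subst chain.simps) simp
    qed
    ultimately show ?thesis using 1 False by simp
  qed
qed

section \<open>Maxima of an antitone function over tails\<close>

text \<open>The minimum of a tail is itself a record, and by antitonicity it dominates
  \<open>q\<close> on the whole tail.\<close>

lemma peak_tail_eq_peak_records_tail: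
  assumes "finite A" "antimono_on A q"
  shows "peak q {b \<in> A. t < pos b} = peak q {b \<in> records pos A. t < pos b}"
proof (cases "{b \<in> A. t < pos b} = {}")
  case True
  then have "{b \<in> records pos A. t < pos b} = {}"
    using records_subset[of pos A] by auto
  then show ?thesis by (simp only: True)
next
  case False
  let ?m = "Min {b \<in> A. t < pos b}"
  note m = Min_tail_in_records[OF assms(1) False]
  have "q b \<le> q ?m" if "b \<in> A" "t < pos b" for b
    using assms that m(1) records_subset[of pos A]
    by (intro monotone_onD[OF assms(2), simplified]) (auto intro!: Min_le)
  then show ?thesis
    using m assms(1) records_subset[of pos A]
    by (intro peak_cong_dominated) auto
qed

text \<open>A record is smaller than everything behind it, so an earlier record cannot have the
  larger index.\<close>

lemma records_tail_eq:
  assumes "a \<in> records pos A" "inj_on pos A"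
  shows "{b \<in> records pos A. pos a < pos b} = {b \<in> records pos A. a < b}"
  using assms by (auto simp: records_def) (metis inj_on_eq_iff linorder_neqE_nat less_asym)

lemma peak_tail_strict:
  assumes "finite A" "antimono_on A q" "inj_on pos A" "a \<in> records pos A"
  shows "peak q {b \<in> A. pos a < pos b} = peak q {b \<in> records pos A. a < b}"
  using peak_tail_eq_peak_records_tail[OF assms(1,2)] records_tail_eq[OF assms(4,3)] by metis

text \<open>Everything behind a record has a larger index, hence no larger value of
  \<open>q\<close>. With \<open>peak_tail_strict\<close>, the drop at a record is its gap.\<close>

lemma peak_tail_records:
  assumes "finite A" "antimono_on A q" "inj_on pos A" "a \<in> records pos A" "0 \<le> q a"
  shows "peak q {b \<in> A. pos a \<le> pos b} = q a"
proof (rule peak_eq)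
  show "a \<in> {b \<in> A. pos a \<le> pos b}"
    using assms records_subset by auto
  show "q b \<le> q a" if "b \<in> {b \<in> A. pos a \<le> pos b}" for b
  proof -
    have "b = a \<or> a < b"
      using that assms by (auto simp: records_def le_less inj_on_eq_iff)
    then show ?thesis
      using that assms(2,4) records_subset[of pos A] by (auto simp: monotone_on_def)
  qed
qed (use assms in auto)

text \<open>A non-record in \<open>A\<close> has a smaller index behind it, whose \<open>q\<close>
  is at least as large; an \<open>a\<close> outside \<open>A\<close> does not occur in the tail at
  all.\<close>

lemma peak_tail_non_record:
  assumes "finite A" "antimono_on A q" "inj_on pos (insert a A)" "a \<notin> records pos A"
  shows "peak q {b \<in> A. pos a \<le> pos b} = peak q {b \<in> A. pos a < pos b}"
proof (cases "a \<in> A")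
  case True
  then obtain c where c: "c \<in> A" "pos a < pos c" "c \<le> a"
    using assms(4) by (auto simp: records_def not_less)
  then have "q a \<le> q c"
    using True assms(2) by (auto simp: monotone_on_def)
  moreover have "b = a" if "b \<in> A" "pos a \<le> pos b" "\<not> pos a < pos b" for b
    using that assms(3) True by (auto simp: inj_on_eq_iff)
  ultimately show ?thesis
    using assms(1) c by (intro peak_cong_dominated) (simp, simp, force, force)
next
  case False
  then have "pos b \<noteq> pos a" if "b \<in> A" for b
    using that inj_onD[OF assms(3), of b a] by blast
  then have "pos a \<le> pos b \<longleftrightarrow> pos a < pos b" if "b \<in> A" for b
    using that by (metis le_less)
  then have "{b \<in> A. pos a \<le> pos b} = {b \<in> A. pos a < pos b}"
    by blast
  then show ?thesis by simp
qed

section \<open>Mixing inequalities in terms of gaps\<close>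

text \<open>Here ties are resolved. If an element listed after \<open>\<sigma> k\<close> ties with
  it, both sides equal the tied value, because the last listed of the tied elements has the greatest
  index. Otherwise \<open>\<sigma> k\<close> is itself the last of its ties, and the elements listed
  later are exactly those of larger index.\<close>

lemma q_ext_Suc:
  assumes "finite K" "antimono_on K q" "\<And>a. a \<in> K \<Longrightarrow> 0 \<le> q a"
    and "q_ordering q K \<sigma>" "ties_admissible q K \<sigma>" "k \<in> {1..card K}"
  shows "q_ext q K \<sigma> (k + 1) = peak q {b \<in> K. \<sigma> k < b}"
proof -
  have bij: "bij_betw \<sigma> {1..card K} K"
    and ord: "\<And>k l. \<lbrakk>k \<in> {1..card K}; l \<in> {1..card K}; k \<le> l\<rbrakk> \<Longrightarrow> q (\<sigma> l) \<le> q (\<sigma> k)"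
    using assms(4) by (auto simp: q_ordering_def)
  have inK: "\<sigma> l \<in> K" if "l \<in> {1..card K}" for l
    using bij that by (auto simp: bij_betw_def)
  have anti: "q b \<le> q a" if "a \<in> K" "b \<in> K" "a \<le> b" for a b
    using assms(2) that by (auto simp: monotone_on_def)
  show ?thesis
  proof (cases "\<exists>l\<in>{1..card K}. k < l \<and> q (\<sigma> l) = q (\<sigma> k)")
    case True
    then obtain l where l: "l \<in> {1..card K}" "k < l" "q (\<sigma> l) = q (\<sigma> k)" by blast
    \<comment> \<open>Positions of all elements tied with \<open>\<sigma> k\<close>; admissibility
      concerns the last of them.\<close>
    define G where "G = {l \<in> {1..card K}. q (\<sigma> l) = q (\<sigma> k)}"
    have G: "finite G" "l \<in> G" "k \<in> G"
      using l assms(6) by (auto simp: G_def)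
    define m where "m = Max G"
    have m: "m \<in> G" "l \<le> m"
      using G Max_in[of G] unfolding m_def by (blast, auto)
    have "q (\<sigma> j) < q (\<sigma> m)" if "j \<in> {1..card K}" "m < j" for j
    proof -
      have "j \<notin> G"
        using that(2) Max_ge[OF G(1), of j] unfolding m_def by linarith
      then show ?thesis
        using that m ord[of m j] by (auto simp: G_def)
    qed
    then have "\<sigma> k \<le> \<sigma> m"
      using assms(5,6) m(1) by (auto simp: ties_admissible_def G_def)
    moreover have "\<sigma> k \<noteq> \<sigma> m"
      using bij m l(2) assms(6) by (auto simp: bij_betw_def inj_on_eq_iff G_def)
    ultimately have "peak q {b \<in> K. \<sigma> k < b} = q (\<sigma> m)"
      using m(1) assms(1,3,6) inK anti
      by (intro peak_eq) (auto simp: G_def)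
    \<comment> \<open>Position \<open>k + 1\<close> lies between the tied positions \<open>k\<close>
      and \<open>l\<close>.\<close>
    moreover have "q (\<sigma> (k + 1)) = q (\<sigma> k)"
      using ord[of k "k + 1"] ord[of "k + 1" l] l assms(6) by fastforce
    ultimately show ?thesis
      using m(1) l assms(6) by (auto simp: q_ext_def G_def)
  next
    case False
    then have less: "q (\<sigma> l) < q (\<sigma> k)" if "l \<in> {1..card K}" "k < l" for l
      using that ord[of k l] assms(6) by force
    have iff: "\<sigma> k < \<sigma> l \<longleftrightarrow> k < l" if l: "l \<in> {1..card K}" for l
    proof
      assume "k < l"
      then show "\<sigma> k < \<sigma> l"
        using less[of l] anti[of "\<sigma> l" "\<sigma> k"] inK l assms(6) by force
    next
      assume lt: "\<sigma> k < \<sigma> l"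
      show "k < l"
      proof (rule ccontr)
        assume "\<not> k < l"
        \<comment> \<open>The ordering gives one inequality, the larger index and antitonicity the
          other; this tie contradicts admissibility at \<open>k\<close>.\<close>
        then have "q (\<sigma> l) = q (\<sigma> k)"
          using ord[of l k] anti[of "\<sigma> k" "\<sigma> l"] lt l inK assms(6) by force
        then show False
          using assms(5,6) less l lt by (force simp: ties_admissible_def)
      qed
    qed
    have "{b \<in> \<sigma> ` {1..card K}. \<sigma> k < b} = \<sigma> ` {l \<in> {1..card K}. k < l}"
      using iff by blast
    then have eq: "{b \<in> K. \<sigma> k < b} = \<sigma> ` {l \<in> {1..card K}. k < l}"
      using bij by (simp only: bij_betw_def)
    show ?thesis
    \<comment> \<open>At the last position the convention value 0 meets the maximum over the empty
      set.\<close>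
    proof (cases "k = card K")
      case True
      then have "{b \<in> K. \<sigma> k < b} = {}"
        unfolding eq by auto
      then show ?thesis
        using True by (simp only: q_ext_def) simp
    next
      case F: False
      then have "peak q {b \<in> K. \<sigma> k < b} = q (\<sigma> (k + 1))"
        using assms(1,3,6) inK ord[of "k + 1"] unfolding eq by (intro peak_eq) auto
      then show ?thesis
        using F by (simp add: q_ext_def)
    qed
  qed
qed

text \<open>The right-hand side is free of \<open>\<sigma>\<close>, so this sum is the same for all
  admissible orderings and can be compared with the SEPI.\<close>

lemma mixing_sum_eq:
  assumes "finite K" "antimono_on K q" "\<And>a. a \<in> K \<Longrightarrow> 0 \<le> q a"
    and "q_ordering q K \<sigma>" "ties_admissible q K \<sigma>"
  shows "(\<Sum>k=1..card K. (q_ext q K \<sigma> k - q_ext q K \<sigma> (k + 1)) * (1 - x (\<sigma> k))) =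
    (\<Sum>a\<in>K. (q a - peak q {b \<in> K. a < b}) * (1 - x a))"
proof -
  have bij: "bij_betw \<sigma> {1..card K} K"
    using assms(4) by (simp add: q_ordering_def)
  have "(\<Sum>k=1..card K. (q_ext q K \<sigma> k - q_ext q K \<sigma> (k + 1)) * (1 - x (\<sigma> k))) =
    (\<Sum>k=1..card K. (q (\<sigma> k) - peak q {b \<in> K. \<sigma> k < b}) * (1 - x (\<sigma> k)))"
    by (intro sum.cong refl) (simp add: q_ext_Suc[OF assms, simplified], simp add: q_ext_def)
  also have "\<dots> = (\<Sum>a\<in>K. (q a - peak q {b \<in> K. a < b}) * (1 - x a))"
    by (rule sum.reindex_bij_betw[OF bij])
  finally show ?thesis .
qed

lemma q_ordering_first:
  assumes "finite K" "K \<noteq> {}" "\<And>a. a \<in> K \<Longrightarrow> 0 \<le> q a" "q_ordering q K \<sigma>"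
  shows "q (\<sigma> 1) = peak q K"
proof -
  have bij: "\<sigma> ` {1..card K} = K" and pos: "1 \<in> {1..card K}"
    using assms by (auto simp: q_ordering_def bij_betw_def Suc_le_eq card_gt_0_iff)
  have "q b \<le> q (\<sigma> 1)" if "b \<in> K" for b
  proof -
    obtain l where "l \<in> {1..card K}" "b = \<sigma> l"
      using bij \<open>b \<in> K\<close> by blast
    then show ?thesis
      using assms(4) pos by (auto simp: q_ordering_def)
  qed
  moreover have "\<sigma> 1 \<in> K"
    using bij pos by blast
  ultimately show ?thesis
    using assms(1,3) by (intro peak_eq[symmetric]) auto
qed

text \<open>An element of greater index than the last listed one would tie with it, since
  antitonicity and the ordering bound \<open>q\<close> in opposite directions; admissibility forbids
  this.\<close>

lemma q_ordering_last:
  assumes "finite K" "K \<noteq> {}" "antimono_on K q" "q_ordering q K \<sigma>" "ties_admissible q K \<sigma>"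
  shows "\<sigma> (card K) = Max K"
proof (rule Max_eqI[symmetric])
  have bij: "\<sigma> ` {1..card K} = K" and pos: "card K \<in> {1..card K}"
    using assms by (auto simp: q_ordering_def bij_betw_def Suc_le_eq card_gt_0_iff)
  then show last: "\<sigma> (card K) \<in> K"
    by blast
  show "b \<le> \<sigma> (card K)" if b: "b \<in> K" for b
  proof (rule ccontr)
    assume less: "\<not> b \<le> \<sigma> (card K)"
    obtain l where l: "l \<in> {1..card K}" "b = \<sigma> l"
      using bij b by blast
    have "q b \<le> q (\<sigma> (card K))"
      using assms(3) b last less by (auto simp: monotone_on_def)
    moreover have "q (\<sigma> (card K)) \<le> q b"
      using assms(4) l pos by (auto simp: q_ordering_def)
    ultimately show False
      using assms(5) l pos less by (auto simp: ties_admissible_def)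
  qed
qed (use assms in auto)

text \<open>Listing \<open>K\<close> by increasing index works. This keeps the quantification over
  orderings in the theorem from being vacuous.\<close>

lemma ex_admissible_ordering:
  assumes "finite K" "antimono_on K q"
  shows "\<exists>\<sigma>. q_ordering q K \<sigma> \<and> ties_admissible q K \<sigma>"
proof -
  obtain h where h: "bij_betw h {..<card K} K" "strict_mono_on {..<card K} h"
    using ex_bij_betw_strict_mono_card[OF assms(1)] by blast
  define \<sigma> where "\<sigma> = h \<circ> (\<lambda>k. k - 1)"
  have "bij_betw (\<lambda>k. k - 1) {1..card K} {..<card K}"
    by (rule bij_betw_byWitness[where f' = Suc]) auto
  then have bij: "bij_betw \<sigma> {1..card K} K"
    unfolding \<sigma>_def using h(1) by (rule bij_betw_trans)
  have mono: "\<sigma> k \<le> \<sigma> l" if "k \<in> {1..card K}" "l \<in> {1..card K}" "k \<le> l" for k l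
    unfolding \<sigma>_def comp_def using that by (intro strict_mono_on_leD[OF h(2)]) auto
  have "q (\<sigma> l) \<le> q (\<sigma> k)" if "k \<in> {1..card K}" "l \<in> {1..card K}" "k \<le> l" for k l
    using monotone_onD[OF assms(2), of "\<sigma> k" "\<sigma> l"] mono[OF that] bij_betwE[OF bij] that by simp
  then have "q_ordering q K \<sigma>"
    using bij by (simp add: q_ordering_def)
  moreover have "ties_admissible q K \<sigma>"
    unfolding ties_admissible_def using mono by (metis less_irrefl linorder_le_less_linear)
  ultimately show ?thesis by blast
qed

section \<open>The function \<open>f\<close> and the SEPI along the path from \<open>p\<close> to
  \<open>p + 1\<close>\<close>

locale mixing_data =
  fixes n :: nat and q :: "nat \<Rightarrow> real" and p :: "nat \<Rightarrow> int" and \<delta> :: "nat \<Rightarrow> nat"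
  assumes n_pos: "n \<ge> 1"
    and q_range: "\<And>i. i \<in> {1..n} \<Longrightarrow> 0 \<le> q i \<and> q i < 1"
    and q_anti: "\<And>i j. i \<in> {1..n} \<Longrightarrow> j \<in> {1..n} \<Longrightarrow> i \<le> j \<Longrightarrow> q i \<ge> q j"
    and \<delta>_permutes: "\<delta> permutes {1..n}"
begin

abbreviation pos :: "nat \<Rightarrow> nat" where
  "pos \<equiv> inv \<delta>"

lemma inj_pos: "inj pos"
  using \<delta>_permutes permutes_inv permutes_inj by blast

lemma inj_on_pos: "inj_on pos A"
  using inj_pos inj_on_subset by blast

lemma pos_ge_1: "k \<in> {1..n} \<Longrightarrow> 1 \<le> pos k"
  using permutes_in_image[OF permutes_inv[OF \<delta>_permutes], of k] by auto

lemma antimono_on_q: "A \<subseteq> {1..n} \<Longrightarrow> antimono_on A q"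
  by (auto simp: monotone_on_def intro!: q_anti)

lemma shifted_eq:
  assumes "k \<in> {1..n}"
  shows "shifted p \<delta> i k = p k + (if pos k \<le> i then 1 else 0)"
proof -
  have "k = \<delta> j \<longleftrightarrow> j = pos k" for j
    using permutes_inv_eq[OF \<delta>_permutes] by metis
  then show ?thesis
    using pos_ge_1[OF assms] by (simp add: shifted_def unit_vec_def)
qed

lemma shifted_0 [simp]: "shifted p \<delta> 0 = p"
  by (simp add: shifted_def)

text \<open>As \<open>q\<close> is below 1, a coordinate above \<open>v\<close> contributes less
  than \<open>- v\<close>, so only those at \<open>v\<close> compete. The 0 inside
  \<open>peak\<close> stands for the outer maximum of \<open>f\<close> if \<open>v = 0\<close>; if
  \<open>v < 0\<close> it does no harm, because some coordinate attains \<open>v\<close>.\<close>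

lemma mix_fun_eq_peak:
  fixes v :: int
  assumes "\<And>k. k \<in> {1..n} \<Longrightarrow> v \<le> x k" "v \<le> 0" "v = 0 \<or> (\<exists>k\<in>{1..n}. x k = v)"
  shows "mix_fun n q x = peak q {k \<in> {1..n}. x k = v} - v"
proof (rule antisym)
  let ?S = "{k \<in> {1..n}. x k = v}"
  have "q i - x i \<le> peak q ?S - v" if i: "i \<in> {1..n}" for i
  proof (cases "x i = v")
    case True
    then show ?thesis using peak_ge[of ?S i q] i by simp
  next
    case False
    then have "real_of_int v + 1 \<le> x i"
      using assms(1)[OF i] by linarith
    then show ?thesis
      using peak_nonneg[of ?S q] q_range[OF i] by simp
  qed
  moreover have "0 \<le> peak q ?S - v"
    using peak_nonneg[of ?S q] assms(2) by simp
  ultimately show "mix_fun n q x \<le> peak q ?S - v"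
    using n_pos by (simp add: mix_fun_def)
  have ge: "q k - x k \<le> mix_fun n q x" if "k \<in> {1..n}" for k
    using that by (auto simp: mix_fun_def le_max_iff_disj intro!: disjI2 Max_ge)
  have "0 \<le> mix_fun n q x"
    by (simp add: mix_fun_def)
  moreover have "- real_of_int v \<le> mix_fun n q x"
  proof (cases "v = 0")
    case True
    then show ?thesis using \<open>0 \<le> mix_fun n q x\<close> by simp
  next
    case False
    then obtain k where "k \<in> {1..n}" "x k = v" using assms(3) by blast
    then show ?thesis using ge[of k] q_range[of k] by simp
  qed
  ultimately have "peak q ?S \<le> mix_fun n q x + v"
    using ge by (auto simp: peak_le_iff algebra_simps)
  then show "peak q ?S - v \<le> mix_fun n q x" by simp
qed

lemma SEPI_iff:
  "SEPI n f p \<delta> x w \<longleftrightarrow>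
     w \<ge> f p + (\<Sum>a=1..n. (f (shifted p \<delta> (pos a)) - f (shifted p \<delta> (pos a - 1))) * (x a - p a))"
proof -
  have "pos (\<delta> i) = i" for i
    using permutes_inverses(2)[OF \<delta>_permutes] .
  then show ?thesis
    unfolding SEPI_def
    using sum.reindex_bij_betw[OF permutes_imp_bij[OF \<delta>_permutes],
        of "\<lambda>a. (f (shifted p \<delta> (pos a)) - f (shifted p \<delta> (pos a - 1))) * (x a - p a)"]
    by simp
qed

lemma p_min_le: "k \<in> {1..n} \<Longrightarrow> p_min n p \<le> p k"
  by (simp add: p_min_def)

lemma level_p_min_nonempty: "level n p (p_min n p) \<noteq> {}"
proof -
  have "p_min n p \<in> p ` {1..n}"
    unfolding p_min_def using n_pos by (intro Min_in) auto
  then show ?thesis by (auto simp: level_def)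
qed

lemma finite_level [simp]: "finite (level n p v)" and level_subset: "level n p v \<subseteq> {1..n}"
  by (auto simp: level_def)

lemma set_K_first: "set (K_first n p \<delta>) = records pos (level n p (p_min n p))"
proof -
  let ?A = "level n p (p_min n p)"
  \<comment> \<open>Positions start at 1, so the tail beyond 0 is everything and its first record is
    \<open>Min ?A\<close>, where the chain starts.\<close>
  have eq: "{a \<in> ?A. 0 < pos a} = ?A" "{a \<in> records pos ?A. 0 < pos a} = records pos ?A"
    using pos_ge_1 level_subset records_subset[of pos ?A] by force+
  show ?thesis
    using records_tail_step[of ?A pos 0] level_p_min_nonempty
    unfolding K_first_def Let_def eq by (simp add: set_chain inj_on_pos)
qed

section \<open>The case of a nonnegative minimum\<close>

lemma mix_fun_shifted_nonneg:
  assumes "0 \<le> p_min n p"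
  shows "mix_fun n q (shifted p \<delta> t) = peak q {a \<in> level n p 0. t < pos a}"
proof -
  have p: "0 \<le> p k" if "k \<in> {1..n}" for k
    using p_min_le[OF that] assms by linarith
  have "{k \<in> {1..n}. shifted p \<delta> t k = 0} = {a \<in> level n p 0. t < pos a}"
    using p by (auto simp: shifted_eq level_def add_nonneg_eq_0_iff split: if_splits)
  then show ?thesis
    using p mix_fun_eq_peak[of 0 "shifted p \<delta> t"] by (simp add: shifted_eq)
qed

text \<open>Raising \<open>a\<close> lowers \<open>f\<close> by the gap of \<open>a\<close> if
  \<open>a\<close> is a record, and changes nothing otherwise. Records have \<open>p a = 0\<close>,
  and \<open>f p\<close> is the sum of all gaps by telescoping, so each gap receives the factor
  \<open>1 - x a\<close>.\<close>

lemma SEPI_nonneg: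
  assumes "0 \<le> p_min n p"
  defines "K \<equiv> records pos (level n p 0)"
  shows "SEPI n (mix_fun n q) p \<delta> x w \<longleftrightarrow>
    w \<ge> (\<Sum>a\<in>K. (q a - peak q {b \<in> K. a < b}) * (1 - x a))"
proof -
  let ?A = "level n p 0" and ?gap = "\<lambda>a. q a - peak q {b \<in> K. a < b}"
  let ?F = "\<lambda>t. mix_fun n q (shifted p \<delta> t)"
  have F: "?F t = peak q {a \<in> ?A. t < pos a}" for t
    using mix_fun_shifted_nonneg[OF assms(1)] .
  have sub: "K \<subseteq> ?A" "K \<subseteq> {1..n}"
    using records_subset[of pos ?A] level_subset by (auto simp: K_def)
  have anti: "antimono_on ?A q" "antimono_on K q"
    using antimono_on_q level_subset sub by auto
  have diff: "?F (pos a) - ?F (pos a - 1) = (if a \<in> K then - ?gap a else 0)" if a: "a \<in> {1..n}" for a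
  proof -
    \<comment> \<open>The subtraction in \<open>pos a - 1\<close> is truncated, so
      \<open>pos a\<close> must be at least 1.\<close>
    have "{b \<in> ?A. pos a - 1 < pos b} = {b \<in> ?A. pos a \<le> pos b}"
      using pos_ge_1[OF a] by auto
    then have "?F (pos a) - ?F (pos a - 1) = peak q {b \<in> ?A. pos a < pos b} - peak q {b \<in> ?A. pos a \<le> pos b}"
      by (simp add: F)
    then show ?thesis
      using peak_tail_strict[OF finite_level anti(1) inj_on_pos, of a]
        peak_tail_records[OF finite_level anti(1) inj_on_pos, of a]
        peak_tail_non_record[OF finite_level anti(1) inj_on_pos, of a] q_range[OF a]
      by (auto simp: K_def)
  qed
  have "?F 0 = peak q {b \<in> K. 0 < pos b}"
    unfolding F K_def by (rule peak_tail_eq_peak_records_tail[OF finite_level anti(1)])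
  also have "{b \<in> K. 0 < pos b} = K"
    using pos_ge_1 sub by force
  also have "peak q K = (\<Sum>a\<in>K. ?gap a)"
    using sub q_range anti(2) by (intro sum_peak_gaps[symmetric]) (auto simp: K_def)
  finally have F0: "mix_fun n q p = (\<Sum>a\<in>K. ?gap a)"
    by simp
  have "(\<Sum>a=1..n. (?F (pos a) - ?F (pos a - 1)) * (x a - p a)) = (\<Sum>a\<in>K. - ?gap a * x a)"
  proof (rule sum.mono_neutral_cong_right)
    show "(?F (pos a) - ?F (pos a - 1)) * (x a - p a) = - ?gap a * x a" if "a \<in> K" for a
      using that sub by (subst diff) (auto simp: level_def)
  qed (use sub diff in auto)
  then have "mix_fun n q p + (\<Sum>a=1..n. (?F (pos a) - ?F (pos a - 1)) * (x a - p a)) =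
      (\<Sum>a\<in>K. ?gap a * (1 - x a))"
    unfolding F0 by (simp only: sum.distrib[symmetric]) (simp add: algebra_simps)
  then show ?thesis
    unfolding SEPI_iff by simp
qed

section \<open>The case of a negative minimum\<close>

lemma mix_fun_shifted_lower:
  assumes "p_min n p \<le> 0" "c \<in> level n p (p_min n p)" "t < pos c"
  shows "mix_fun n q (shifted p \<delta> t) = peak q {a \<in> level n p (p_min n p). t < pos a} - p_min n p"
proof -
  let ?m = "p_min n p"
  have "shifted p \<delta> t k = ?m \<longleftrightarrow> p k = ?m \<and> t < pos k" if "k \<in> {1..n}" for k
    using p_min_le[OF that] by (auto simp: shifted_eq[OF that])
  then have "{k \<in> {1..n}. shifted p \<delta> t k = ?m} = {a \<in> level n p ?m. t < pos a}"
    by (auto simp: level_def)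
  moreover have "\<exists>k\<in>{1..n}. shifted p \<delta> t k = ?m"
    using assms(2,3) by (intro bexI[of _ c]) (auto simp: level_def shifted_eq)
  ultimately show ?thesis
    using p_min_le assms(1) mix_fun_eq_peak[of ?m "shifted p \<delta> t"] by (simp add: shifted_eq add_increasing2)
qed

text \<open>The fully raised lowest level merges with the elements of the next level still waiting.
  Their common value is at most 0, so \<open>mix_fun_eq_peak\<close> applies again.\<close>

lemma mix_fun_shifted_upper:
  assumes "p_min n p < 0" "\<And>c. c \<in> level n p (p_min n p) \<Longrightarrow> pos c \<le> t"
  shows "mix_fun n q (shifted p \<delta> t) =
    peak q (level n p (p_min n p) \<union> {b \<in> level n p (p_min n p + 1). t < pos b}) - (p_min n p + 1)"
proof -
  let ?m = "p_min n p"
  have ge: "?m + 1 \<le> shifted p \<delta> t k" if k: "k \<in> {1..n}" for k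
  proof (cases "p k = ?m")
    case True
    then show ?thesis using k assms(2)[of k] by (simp add: shifted_eq level_def)
  next
    case False
    then show ?thesis using k p_min_le[OF k] by (simp add: shifted_eq)
  qed
  have "{k \<in> {1..n}. shifted p \<delta> t k = ?m + 1} =
      level n p ?m \<union> {b \<in> level n p (?m + 1). t < pos b}" (is "?S = ?R")
  proof (intro equalityI subsetI)
    fix k assume "k \<in> ?S"
    then show "k \<in> ?R"
      by (auto simp: shifted_eq level_def split: if_splits)
  next
    fix k assume "k \<in> ?R"
    then show "k \<in> ?S"
      using assms(2)[of k] by (auto simp: shifted_eq level_def)
  qed
  moreover from this have "\<exists>k\<in>{1..n}. shifted p \<delta> t k = ?m + 1"
    using level_p_min_nonempty by blast
  ultimately show ?thesis
    using ge assms(1) mix_fun_eq_peak[of "?m + 1" "shifted p \<delta> t"] by simp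
qed

definition k_first :: nat where
  "k_first = Min (level n p (p_min n p))"

definition k_last :: nat where
  "k_last = last (K_first n p \<delta>)"

text \<open>The part of the next level that matters once \<open>k_last\<close> is raised: larger
  indices than \<open>k_first\<close> are dominated by it, and earlier positions are already
  raised.\<close>

definition tail_above :: "nat set" where
  "tail_above = {b \<in> level n p (p_min n p + 1). b < k_first \<and> pos k_last < pos b}"

lemma k_first_in: "k_first \<in> level n p (p_min n p)"
  and k_first_le: "a \<in> level n p (p_min n p) \<Longrightarrow> k_first \<le> a"
  unfolding k_first_def using level_p_min_nonempty by auto

lemma k_last_in: "k_last \<in> level n p (p_min n p)"
  and pos_le_k_last: "a \<in> level n p (p_min n p) \<Longrightarrow> pos a \<le> pos k_last"
  using last_chain[OF finite_level k_first_in, of pos]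
  by (auto simp: k_last_def K_first_def Let_def k_first_def)

text \<open>The chain runs through all of the next level below \<open>k_first\<close>, but it starts
  behind \<open>k_last\<close> and only looks ahead, so it stays in
  \<open>tail_above\<close>.\<close>

lemma set_K_second: "set (K_second n p \<delta>) = records pos tail_above"
proof -
  let ?A = "{i \<in> level n p (p_min n p + 1). i < k_first}"
  have T: "tail_above = {i \<in> ?A. pos k_last < pos i}"
    by (auto simp: tail_above_def)
  have K: "K_second n p \<delta> = (if tail_above = {} then [] else chain ?A pos (Min tail_above))"
    unfolding K_second_def T k_last_def k_first_def by (simp only: K_first_def Let_def hd_chain)
  show ?thesis
  proof (cases "tail_above = {}")
    case True
    then show ?thesis by (simp add: K records_def)
  next
    case False
    then show ?thesis
      using records_tail_step[of ?A pos "pos k_last"]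
      unfolding K T records_tail by (simp add: set_chain inj_on_pos)
  qed
qed

lemma K_set_eq:
  "K_set n p \<delta> = (if p_min n p \<ge> 0 then records pos (level n p 0)
    else records pos (level n p (p_min n p)) \<union> records pos tail_above)"
proof -
  \<comment> \<open>This merges the case \<open>p_min n p \<ge> 1\<close>, where \<open>K\<close> is
    empty, with the case of minimum 0.\<close>
  have "level n p 0 = {}" if "p_min n p \<ge> 1"
    using that p_min_le by (force simp: level_def)
  then show ?thesis
    using set_K_first by (cases "p_min n p = 0") (auto simp: K_set_def set_K_second records_def)
qed

lemma K_set_subset: "K_set n p \<delta> \<subseteq> {1..n}"
  unfolding K_set_eq using level_subset by (auto simp: records_def tail_above_def level_def)

text \<open>Before \<open>k_last\<close> and after it, \<open>f\<close> drops by gaps as in the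
  nonnegative case. At \<open>k_last\<close> the two formulas for \<open>f\<close> meet, which adds
  \<open>peak q K - 1\<close> to the coefficient of that variable.\<close>

lemma SEPI_neg:
  assumes "p_min n p < 0"
  defines "K \<equiv> K_set n p \<delta>"
  shows "SEPI n (mix_fun n q) p \<delta> x w \<longleftrightarrow>
    w \<ge> (\<Sum>a\<in>K. (q a - peak q {b \<in> K. a < b}) * (1 - x a)) - (1 - peak q K) * x (Max K)"
proof -
  let ?m = "p_min n p"
  let ?A = "level n p ?m" and ?T = tail_above and ?kL = k_last
  let ?F = "\<lambda>t. mix_fun n q (shifted p \<delta> t)"
  define gap where "gap a = q a - peak q {b \<in> K. a < b}" for a
  have K: "K = records pos ?A \<union> records pos ?T"
    using assms(1) by (simp add: K_def K_set_eq)
  have fin: "finite ?A" "finite ?T" "finite K"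
    using K by (auto simp: tail_above_def)
  have sub: "K \<subseteq> {1..n}" "?A \<subseteq> {1..n}" "?T \<subseteq> {1..n}"
    using K_set_subset level_subset by (auto simp: K_def tail_above_def)
  have recs: "records pos ?A \<subseteq> ?A" "records pos ?T \<subseteq> ?T"
    by (rule records_subset)+
  have anti: "antimono_on ?A q" "antimono_on ?T q" "antimono_on K q" "antimono_on (records pos ?A) q"
    using antimono_on_q sub recs by (meson subset_trans)+
  have q0: "0 \<le> q a" if "a \<in> {1..n}" for a
    using q_range that by simp
  have T_less: "b < a" "pos ?kL < pos b" "b \<notin> ?A" if "a \<in> ?A" "b \<in> ?T" for a b
    using that k_first_le[of a] by (auto simp: tail_above_def level_def)
  have kL: "?kL \<in> records pos ?A"
    using k_last_in pos_le_k_last by (auto simp: records_def not_less[symmetric])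
  have peak_recs: "peak q (records pos S) = peak q S" if "S \<subseteq> {1..n}" "finite S" for S
  proof -
    have "{b \<in> S. 0 < pos b} = S" "{b \<in> records pos S. 0 < pos b} = records pos S"
      using that pos_ge_1 records_subset[of pos S] by force+
    then show ?thesis
      using peak_tail_eq_peak_records_tail[OF that(2) antimono_on_q[OF that(1)], of 0 pos] by simp
  qed
  have peak_K: "peak q K = max (peak q ?A) (peak q ?T)"
    using fin sub by (simp add: K peak_Un peak_recs)
  have Max_K: "Max K = ?kL"
  proof (rule Max_eqI)
    show "b \<le> ?kL" if b: "b \<in> K" for b
    proof (cases "b \<in> ?A")
      case True
      then have "b \<in> records pos ?A"
        using b K recs T_less(3) by blast
      then show ?thesis
        using True pos_le_k_last[OF True] k_last_in inj_on_pos[of ?A]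
        by (cases "b = ?kL") (auto simp: records_def le_less inj_on_eq_iff)
    next
      case False
      then have "b \<in> ?T" using b K recs by blast
      then show ?thesis using T_less(1)[OF k_last_in] by (simp add: less_imp_le)
    qed
  qed (use kL K fin in auto)
  \<comment> \<open>All of \<open>?T\<close> has smaller indices than \<open>?A\<close>, so gaps in
    the lowest level do not see \<open>?T\<close>.\<close>
  have above: "{b \<in> K. a < b} = {b \<in> records pos ?A. a < b}" if "a \<in> ?A" for a
  proof -
    have "b \<notin> records pos ?T" if "a < b" for b
      using T_less(1)[OF \<open>a \<in> ?A\<close>, of b] that recs(2) by (meson less_asym subsetD)
    then show ?thesis
      unfolding K by blast
  qed
  have F_lower: "?F t = peak q {a \<in> ?A. t < pos a} - ?m" if "t < pos ?kL" for t
    using mix_fun_shifted_lower[OF _ k_last_in that] assms(1) by simp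
  have F_upper: "?F t = max (peak q ?A) (peak q {b \<in> ?T. t < pos b}) - (?m + 1)"
    if t: "pos ?kL \<le> t" for t
  proof -
    let ?B = "level n p (?m + 1)"
    have "peak q (?A \<union> {b \<in> ?B. t < pos b}) = peak q (?A \<union> {b \<in> ?T. t < pos b})"
    proof (rule peak_cong_dominated)
      show "\<exists>b\<in>?A \<union> {b \<in> ?T. t < pos b}. q a \<le> q b" if a: "a \<in> ?A \<union> {b \<in> ?B. t < pos b}" for a
      proof (cases "a \<in> ?A \<or> a < k_first")
        case True
        then show ?thesis using a t by (intro bexI[of _ a]) (auto simp: tail_above_def)
      next
        case False
        then have "q a \<le> q k_first"
          using a k_first_in level_subset by (intro q_anti) (auto simp: level_def)
        then show ?thesis using k_first_in by auto
      qed
      show "\<exists>a\<in>?A \<union> {b \<in> ?B. t < pos b}. q b \<le> q a" if "b \<in> ?A \<union> {b \<in> ?T. t < pos b}" for b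
        using that by (intro bexI[of _ b]) (auto simp: tail_above_def)
    qed (use fin in auto)
    then show ?thesis
      using mix_fun_shifted_upper[OF assms(1), of t] pos_le_k_last t fin
      by (fastforce simp: peak_Un)
  qed
  have diff: "?F (pos a) - ?F (pos a - 1) =
      (if a \<in> K then - gap a else 0) + (if a = ?kL then peak q K - 1 else 0)"
    if a: "a \<in> {1..n}" for a
  proof -
    have tail: "{b \<in> S. pos a - 1 < pos b} = {b \<in> S. pos a \<le> pos b}" for S
      using pos_ge_1[OF a] by auto
    consider "pos a < pos ?kL" | "pos a = pos ?kL" | "pos ?kL < pos a"
      by linarith
    then show ?thesis
    proof cases
      case 1
      then have ne: "a \<noteq> ?kL" "a \<notin> ?T"
        using T_less(2)[OF k_last_in] by (auto dest: less_asym)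
      then have iff: "a \<in> K \<longleftrightarrow> a \<in> records pos ?A"
        using K recs by auto
      have "?F (pos a) - ?F (pos a - 1) = peak q {b \<in> ?A. pos a < pos b} - peak q {b \<in> ?A. pos a \<le> pos b}"
        using 1 by (simp add: F_lower flip: tail)
      then show ?thesis
        using peak_tail_strict[OF fin(1) anti(1) inj_on_pos, of a]
          peak_tail_records[OF fin(1) anti(1) inj_on_pos, of a]
          peak_tail_non_record[OF fin(1) anti(1) inj_on_pos, of a] q_range[OF a] above[of a] ne iff recs
        by (auto simp: gap_def)
    next
      \<comment> \<open>Here \<open>f\<close> passes from \<open>q a - ?m\<close> to
        \<open>peak q K - (?m + 1)\<close>, and the gap of \<open>a\<close> is all of
        \<open>q a\<close> because \<open>a = Max K\<close>.\<close>
      case 2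
      then have a_eq: "a = ?kL"
        using inj_pos by (simp add: inj_eq)
      have empty: "{b \<in> K. ?kL < b} = {}"
        using Max_K fin(3) by (metis (mono_tags, lifting) Collect_empty_eq Max_ge not_le)
      have "{b \<in> ?T. pos ?kL < pos b} = ?T"
        using T_less(2)[OF k_last_in] by auto
      then have "?F (pos a) = peak q K - (?m + 1)"
        by (simp add: F_upper a_eq peak_K)
      moreover have "?F (pos a - 1) = q a - ?m"
        using pos_ge_1[OF a] peak_tail_records[OF fin(1) anti(1) inj_on_pos, of a] kL q_range[OF a]
        unfolding tail[symmetric] by (simp add: F_lower a_eq)
      moreover have "gap a = q a"
        by (simp only: gap_def a_eq empty) simp
      moreover have "a \<in> K"
        using a_eq kL K by simp
      ultimately show ?thesis
        using a_eq by simp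
    next
      case 3
      then have ne: "a \<noteq> ?kL" "a \<notin> ?A"
        using pos_le_k_last[of a] by auto
      then have iff: "a \<in> K \<longleftrightarrow> a \<in> records pos ?T"
        using K recs by auto
      have F: "?F (pos a) - ?F (pos a - 1) =
          max (peak q ?A) (peak q {b \<in> ?T. pos a < pos b}) - max (peak q ?A) (peak q {b \<in> ?T. pos a \<le> pos b})"
        using 3 by (simp add: F_upper flip: tail)
      show ?thesis
      proof (cases "a \<in> records pos ?T")
        case False
        then show ?thesis
          using peak_tail_non_record[OF fin(2) anti(2) inj_on_pos, of a] F iff ne by simp
      next
        case True
        then have "{b \<in> K. a < b} = records pos ?A \<union> {b \<in> records pos ?T. a < b}"
          using K recs T_less(1) by blast
        then have "peak q {b \<in> K. a < b} = max (peak q ?A) (peak q {b \<in> ?T. pos a < pos b})"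
          using fin sub True
          by (simp add: peak_Un peak_recs peak_tail_strict[OF fin(2) anti(2) inj_on_pos])
        \<comment> \<open>Elements of \<open>?T\<close> precede \<open>?A\<close> in index, so
          before \<open>a\<close> is raised the maximum is \<open>q a\<close>, not the one over
          \<open>?A\<close>.\<close>
        moreover have "q b \<le> q a" if "b \<in> ?A" for b
          using q_anti[of a b] T_less(1)[OF that, of a] that True recs(2) sub(2) a
          by (meson less_imp_le subsetD)
        then have "peak q ?A \<le> q a"
          using fin q0[OF a] by (simp add: peak_le_iff)
        ultimately show ?thesis
          using F iff ne True q_range[OF a] peak_tail_records[OF fin(2) anti(2) inj_on_pos True]
          by (simp add: gap_def max_def)
      qed
    qed
  qed
  have "{a \<in> ?A. 0 < pos a} = ?A"
    using pos_ge_1 sub by force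
  then have F0: "mix_fun n q p = peak q ?A - ?m"
    using F_lower[of 0] pos_ge_1[of ?kL] k_last_in sub by (auto simp: Suc_le_eq)
  have gap_A: "(\<Sum>a\<in>records pos ?A. gap a) = peak q ?A"
  proof -
    have "(\<Sum>a\<in>records pos ?A. gap a) = (\<Sum>a\<in>records pos ?A. q a - peak q {b \<in> records pos ?A. a < b})"
      using recs by (intro sum.cong refl) (simp add: gap_def above subset_iff)
    also have "\<dots> = peak q ?A"
      using fin sub recs anti q0 by (subst sum_peak_gaps) (auto simp: peak_recs)
    finally show ?thesis .
  qed
  have gap_K: "(\<Sum>a\<in>K. gap a) = peak q K"
    unfolding gap_def using fin sub anti q0 by (intro sum_peak_gaps) auto
  have disj: "records pos ?A \<inter> records pos ?T = {}"
    using recs T_less(3) by blast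
  then have gap_T: "(\<Sum>a\<in>records pos ?T. gap a) = peak q K - peak q ?A"
    using gap_K gap_A fin by (simp add: K sum.union_disjoint)
  \<comment> \<open>\<open>p\<close> is constant on each of the two groups of records, whose gaps
    have known sums.\<close>
  have gap_p: "(\<Sum>a\<in>K. gap a * p a) = ?m * peak q ?A + (?m + 1) * (peak q K - peak q ?A)"
  proof -
    have "(\<Sum>a\<in>records pos ?A. gap a * p a) = ?m * peak q ?A"
      unfolding gap_A[symmetric] sum_distrib_left
      using recs by (intro sum.cong) (auto simp: level_def mult.commute)
    moreover have "(\<Sum>a\<in>records pos ?T. gap a * p a) = (?m + 1) * (peak q K - peak q ?A)"
      unfolding gap_T[symmetric] sum_distrib_left
      using recs by (intro sum.cong) (auto simp: level_def tail_above_def mult.commute)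
    ultimately show ?thesis
      using fin disj by (simp add: K sum.union_disjoint)
  qed
  have "(\<Sum>a=1..n. (?F (pos a) - ?F (pos a - 1)) * (x a - p a)) =
    (\<Sum>a=1..n. (if a \<in> K then - gap a * (x a - p a) else 0) +
      (if a = ?kL then (peak q K - 1) * (x a - p a) else 0))"
    by (intro sum.cong refl, subst diff) (simp_all add: distrib_right)
  also have "\<dots> = (\<Sum>a\<in>K. - gap a * (x a - p a)) + (peak q K - 1) * (x ?kL - ?m)"
    using sub k_last_in by (simp add: sum.distrib sum.If_cases Int_absorb1 level_def)
  also have "\<dots> = (\<Sum>a\<in>K. gap a * p a) - (\<Sum>a\<in>K. gap a * x a) + (peak q K - 1) * (x ?kL - ?m)"
    by (simp add: algebra_simps sum_subtractf sum_negf)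
  \<comment> \<open>All terms containing \<open>?m\<close> cancel, and the constant collapses to
    \<open>peak q K\<close>, the sum of the gaps.\<close>
  finally have "mix_fun n q p + (\<Sum>a=1..n. (?F (pos a) - ?F (pos a - 1)) * (x a - p a)) =
      (\<Sum>a\<in>K. gap a) - (\<Sum>a\<in>K. gap a * x a) - (1 - peak q K) * x ?kL"
    unfolding gap_p gap_K F0 by (simp add: algebra_simps)
  also have "\<dots> = (\<Sum>a\<in>K. gap a * (1 - x a)) - (1 - peak q K) * x (Max K)"
    unfolding Max_K by (simp add: algebra_simps sum_subtractf)
  finally show ?thesis
    unfolding SEPI_iff gap_def by simp
qed

end

theorem proposition3p15:
  fixes n :: nat and q :: "nat \<Rightarrow> real" and p :: "nat \<Rightarrow> int" and \<delta> :: "nat \<Rightarrow> nat"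
  assumes "n \<ge> 1"
    and "\<And>i. i \<in> {1..n} \<Longrightarrow> 0 \<le> q i \<and> q i < 1"
    and "\<And>i j. i \<in> {1..n} \<Longrightarrow> j \<in> {1..n} \<Longrightarrow> i \<le> j \<Longrightarrow> q i \<ge> q j"
    and "\<delta> permutes {1..n}"
  shows "(\<exists>\<sigma>. q_ordering q (K_set n p \<delta>) \<sigma> \<and> ties_admissible q (K_set n p \<delta>) \<sigma>) \<and>
    (\<forall>\<sigma>. q_ordering q (K_set n p \<delta>) \<sigma> \<and> ties_admissible q (K_set n p \<delta>) \<sigma> \<longrightarrow>
      (p_min n p \<ge> 1 \<longrightarrow>
         K_set n p \<delta> = {} \<and>
         SEPI n (mix_fun n q) p \<delta> = (\<lambda>x w. w \<ge> 0) \<and>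
         SEPI n (mix_fun n q) p \<delta> = mixing_ineq1 q (K_set n p \<delta>) \<sigma>) \<and>
      (p_min n p = 0 \<longrightarrow>
         SEPI n (mix_fun n q) p \<delta> = mixing_ineq1 q (K_set n p \<delta>) \<sigma>) \<and>
      (p_min n p \<le> -1 \<longrightarrow>
         SEPI n (mix_fun n q) p \<delta> = mixing_ineq2 q (K_set n p \<delta>) \<sigma>))"
proof -
  interpret mixing_data n q p \<delta>
    using assms by unfold_locales
  let ?K = "K_set n p \<delta>"
  have fin: "finite ?K" and anti: "antimono_on ?K q" and q0: "\<And>a. a \<in> ?K \<Longrightarrow> 0 \<le> q a"
    using K_set_subset finite_subset antimono_on_q q_range by auto
  have nonneg: "SEPI n (mix_fun n q) p \<delta> = mixing_ineq1 q ?K \<sigma>"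
    if "p_min n p \<ge> 0" "q_ordering q ?K \<sigma>" "ties_admissible q ?K \<sigma>" for \<sigma>
  proof -
    have "records pos (level n p 0) = ?K"
      using that(1) by (simp add: K_set_eq)
    then show ?thesis
      by (intro ext) (simp only: mixing_ineq1_def mixing_sum_eq[OF fin anti q0 that(2,3)]
          SEPI_nonneg[OF that(1)])
  qed
  have neg: "SEPI n (mix_fun n q) p \<delta> = mixing_ineq2 q ?K \<sigma>"
    if "p_min n p < 0" "q_ordering q ?K \<sigma>" "ties_admissible q ?K \<sigma>" for \<sigma>
  proof -
    \<comment> \<open>A chain always contains its start, so \<open>?K\<close> has a first and a last
      listed element.\<close>
    have "set (K_first n p \<delta>) \<noteq> {}"
      by (simp add: K_first_def Let_def set_chain inj_on_pos)
    then have "?K \<noteq> {}"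
      using that(1) by (simp add: K_set_def)
    then show ?thesis
      by (intro ext) (simp only: SEPI_neg[OF that(1)] mixing_ineq2_def
          mixing_sum_eq[OF fin anti q0 that(2,3)] q_ordering_first[OF fin _ q0 that(2)]
          q_ordering_last[OF fin _ anti that(2,3)] not_False_eq_True)
  qed
  have empty: "?K = {}" if "p_min n p \<ge> 1"
    using that by (simp add: K_set_def)
  have "mixing_ineq1 q ?K \<sigma> = (\<lambda>x w. w \<ge> 0)" if "p_min n p \<ge> 1" for \<sigma>
    by (intro ext) (simp add: mixing_ineq1_def empty[OF that])
  then have zero: "SEPI n (mix_fun n q) p \<delta> = (\<lambda>x w. w \<ge> 0)"
    if "p_min n p \<ge> 1" "q_ordering q ?K \<sigma>" "ties_admissible q ?K \<sigma>" for \<sigma>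
    using nonneg[OF _ that(2,3)] that(1) by simp
  show ?thesis
    using ex_admissible_ordering[OF fin anti] nonneg neg zero empty by auto
qed

end
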